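(* Let $\sigma>0$ and let $X_{1,1},X_{1,2},X_{2,1},X_{2,2}$ be independent random variables, each with the Rayleigh density $f(x)=\frac{2x}{\sigma}\exp\left(-\frac{x^2}{\sigma}\right)$, $x\ge 0$. Let $\tilde X$ be the first factor of the larger of the two products $X_{1,1}X_{1,2}$ and $X_{2,1}X_{2,2}$. Then $\tilde X$ has density $$f_{\tilde X}(x)=\frac{4x^3}{\sigma^2}\,E_1\left(\frac{x^2}{\sigma}\right),\qquad x>0.$$
   Context: The first factor of the larger product is $\tilde X:=X_{J,1}$, where $J\in\{1,2\}$ is the almost surely unique index maximizing $X_{j,1}X_{j,2}$. $E_1(x)=\int_x^\infty\frac{\exp(-t)}{t}\,dt$ is the exponential integral. *)

theory Defs
  imports "HOL-Probability.Probability"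
begin

definition rayleigh_density :: "real \<Rightarrow> real \<Rightarrow> real" where
  "rayleigh_density \<sigma> x = (if 0 \<le> x then 2 * x / \<sigma> * exp (- (x\<^sup>2 / \<sigma>)) else 0)"

text \<open>The exponential integral. Only arguments \<open>x > 0\<close> are meaningful: for \<open>x \<le> 0\<close> the integrand
  is not integrable and the Bochner integral returns 0.\<close>

definition E1 :: "real \<Rightarrow> real" where
  "E1 x = (LBINT t:{x..}. exp (- t) / t)"

end

(* Given a first factor x and the rival factors y, z, the product x W exceeds y z iff W > y z / x, which has
   probability exp (- (y z / x)^2 / sigma). Averaging over y gives x^2 / (x^2 + z^2), and averaging
   over z gives a exp a E1 a with a = x^2 / sigma, by the substitution t = (x^2 + z^2) / sigma.
   Ties need no separate treatment: the strict and the non-strict comparison have the same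
   probability, and they bound the event {X_J in A} from below and from above. *)
theory Submission
  imports Defs
begin

section \<open>The Rayleigh law: tails, positivity and total mass\<close>

abbreviation rayleigh :: "real \<Rightarrow> real measure" where
  "rayleigh \<sigma> \<equiv> density lborel (\<lambda>x. ennreal (rayleigh_density \<sigma> x))"

lemma rayleigh_density_measurable [measurable]: "rayleigh_density \<sigma> \<in> borel_measurable borel"
  unfolding rayleigh_density_def by measurable

lemma rayleigh_density_nonneg: "\<sigma> > 0 \<Longrightarrow> 0 \<le> rayleigh_density \<sigma> x"
  by (simp add: rayleigh_density_def)

text \<open>The antiderivative is \<open>- exp (- (s * y\<^sup>2))\<close>. The rate
  \<open>s\<close> stays free because two rates occur later: \<open>1 / \<sigma>\<close> for the
  Rayleigh tail itself, and a modified one for the average over a rival factor.\<close>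

lemma nn_integral_gaussian_tail:
  fixes s c :: real
  assumes "s > 0" "c \<ge> 0"
  shows "(\<integral>\<^sup>+y. ennreal (2 * y * s * exp (- (s * y\<^sup>2))) * indicator {c..} y \<partial>lborel)
    = ennreal (exp (- (s * c\<^sup>2)))"
proof -
  have "((\<lambda>y. - exp (- (s * y\<^sup>2))) \<longlongrightarrow> -0) at_top"
    using \<open>s > 0\<close>
    by (intro tendsto_minus filterlim_compose[OF exp_at_bot]
        filterlim_compose[OF filterlim_uminus_at_bot_at_top]
        filterlim_tendsto_pos_mult_at_top[OF tendsto_const] filterlim_pow_at_top filterlim_ident) auto
  then have "(\<integral>\<^sup>+y. ennreal (2 * y * s * exp (- (s * y\<^sup>2))) * indicator {c..} y \<partial>lborel)
    = ennreal (-0 - (- exp (- (s * c\<^sup>2))))"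
    using assms
    by (intro nn_integral_FTC_atLeast[where F = "\<lambda>y. - exp (- (s * y\<^sup>2))"])
       (auto intro!: derivative_eq_intros)
  then show ?thesis by simp
qed

lemma emeasure_rayleigh_atLeast:
  assumes "\<sigma> > 0" "c \<ge> 0"
  shows "emeasure (rayleigh \<sigma>) {c..} = ennreal (exp (- (c\<^sup>2 / \<sigma>)))"
proof -
  have "emeasure (rayleigh \<sigma>) {c..}
    = (\<integral>\<^sup>+y. ennreal (2 * y * (1 / \<sigma>) * exp (- (1 / \<sigma> * y\<^sup>2))) * indicator {c..} y \<partial>lborel)"
    using assms by (subst emeasure_density)
      (auto intro!: nn_integral_cong simp: rayleigh_density_def indicator_def)
  also have "\<dots> = ennreal (exp (- (c\<^sup>2 / \<sigma>)))"
    using assms by (subst nn_integral_gaussian_tail) auto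
  finally show ?thesis .
qed

text \<open>The endpoint \<open>c\<close> is Lebesgue null, so open and closed tails agree. This is
  the source of the equality between strict and non-strict comparison probabilities.\<close>

lemma emeasure_rayleigh_greaterThan:
  assumes "\<sigma> > 0" "c \<ge> 0"
  shows "emeasure (rayleigh \<sigma>) {c<..} = ennreal (exp (- (c\<^sup>2 / \<sigma>)))"
proof -
  have "emeasure (rayleigh \<sigma>) {c<..} = emeasure (rayleigh \<sigma>) {c..}"
    using AE_lborel_singleton[of c]
    by (auto simp: emeasure_density indicator_def intro!: nn_integral_cong_AE elim!: eventually_mono)
  then show ?thesis
    using emeasure_rayleigh_atLeast[OF assms] by simp
qed

text \<open>The density vanishes on the negatives and the point 0 is Lebesgue null. Later integrals
  may therefore assume positive arguments.\<close>

lemma AE_rayleigh_pos: "AE x in rayleigh \<sigma>. x > 0"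
  using AE_lborel_singleton[of 0]
  by (subst AE_density) (auto simp: rayleigh_density_def elim!: eventually_mono)

lemma prob_space_rayleigh:
  assumes "\<sigma> > 0"
  shows "prob_space (rayleigh \<sigma>)"
proof
  \<comment> \<open>Almost all mass lies above 0, so the total mass is the tail from 0, which equals
    \<open>exp 0\<close>.\<close>
  have "emeasure (rayleigh \<sigma>) UNIV = emeasure (rayleigh \<sigma>) {0..}"
    using AE_rayleigh_pos[of \<sigma>] by (intro emeasure_eq_AE) (auto elim!: eventually_mono)
  then show "emeasure (rayleigh \<sigma>) (space (rayleigh \<sigma>)) = 1"
    using emeasure_rayleigh_atLeast[OF assms, of 0] by simp
qed

section \<open>Probability of beating a rival product, and its average over one rival factor\<close>

lemma rayleigh_comparison_event:
  assumes "\<sigma> > 0" "x > 0" "y \<ge> 0" "R = (<) \<or> R = (\<le>)"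
  shows "emeasure (rayleigh \<sigma>) {w. R y (x * w)} = ennreal (exp (- ((y / x)\<^sup>2 / \<sigma>)))"
proof -
  \<comment> \<open>Here \<open>y\<close> stands for the whole rival product. Division by
    \<open>x > 0\<close> leaves a half-line, open or closed according to \<open>R\<close>.\<close>
  have "{w. y < x * w} = {y / x <..}" "{w. y \<le> x * w} = {y / x ..}"
    using \<open>x > 0\<close> by (auto simp: field_simps)
  then show ?thesis
    using assms emeasure_rayleigh_atLeast[of \<sigma> "y / x"] emeasure_rayleigh_greaterThan[of \<sigma> "y / x"]
    by auto
qed

text \<open>Multiplying the Rayleigh density by the Gaussian factor adds the two rates to
  \<open>s\<close>. The result is \<open>1 / (s * \<sigma>)\<close> times the Rayleigh density of
  rate \<open>s\<close>, whose total mass is 1, so only that constant survives.\<close>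

lemma nn_integral_rayleigh_gaussian:
  assumes "\<sigma> > 0" "x > 0"
  shows "(\<integral>\<^sup>+y. ennreal (exp (- ((z * y / x)\<^sup>2 / \<sigma>))) \<partial>rayleigh \<sigma>) = ennreal (x\<^sup>2 / (x\<^sup>2 + z\<^sup>2))"
proof -
  define s where "s = (1 + (z / x)\<^sup>2) / \<sigma>"
  have q: "1 + (z / x)\<^sup>2 > 0"
    by (rule add_pos_nonneg) auto
  have s: "s > 0"
    using assms q by (simp add: s_def)
  have eq: "rayleigh_density \<sigma> y * exp (- ((z * y / x)\<^sup>2 / \<sigma>))
      = 1 / (s * \<sigma>) * (2 * y * s * exp (- (s * y\<^sup>2)))" if "y \<ge> 0" for y
  proof -
    have "exp (- (y\<^sup>2 / \<sigma>)) * exp (- ((z * y / x)\<^sup>2 / \<sigma>)) = exp (- (s * y\<^sup>2))"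
      by (simp add: exp_add[symmetric] s_def power_mult_distrib power_divide add_divide_distrib
          algebra_simps)
    then show ?thesis
      using that assms s by (simp add: rayleigh_density_def)
  qed
  have "(\<integral>\<^sup>+y. ennreal (exp (- ((z * y / x)\<^sup>2 / \<sigma>))) \<partial>rayleigh \<sigma>)
    = (\<integral>\<^sup>+y. ennreal (1 / (s * \<sigma>)) * (ennreal (2 * y * s * exp (- (s * y\<^sup>2))) * indicator {0..} y) \<partial>lborel)"
  proof (subst nn_integral_density, simp, simp, rule nn_integral_cong)
    fix y :: real
    show "ennreal (rayleigh_density \<sigma> y) * ennreal (exp (- ((z * y / x)\<^sup>2 / \<sigma>)))
      = ennreal (1 / (s * \<sigma>)) * (ennreal (2 * y * s * exp (- (s * y\<^sup>2))) * indicator {0..} y)"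
    proof (cases "y \<ge> 0")
      case True
      then show ?thesis
        using eq[OF True] assms s rayleigh_density_nonneg[OF assms(1), of y]
        by (simp flip: ennreal_mult)
    next
      case False
      then show ?thesis by (simp add: rayleigh_density_def)
    qed
  qed
  also have "\<dots> = ennreal (1 / (s * \<sigma>))"
    using nn_integral_gaussian_tail[OF s, of 0] by (simp add: nn_integral_cmult)
  also have "1 / (s * \<sigma>) = x\<^sup>2 / (x\<^sup>2 + z\<^sup>2)"
  proof -
    have "s * \<sigma> = (x\<^sup>2 + z\<^sup>2) / x\<^sup>2"
      using assms by (simp add: s_def field_simps)
    then show ?thesis by simp
  qed
  finally show ?thesis .
qed

section \<open>The exponential integral as an average\<close>

lemma E1_eq_interval_integral: "E1 a = (LBINT t=ereal a..\<infinity>. exp (- t) / t)"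
proof -
  \<comment> \<open>The closed half-line in \<open>E1\<close> and the open range of the interval
    integral differ by one null point. The interval form is the one the substitution rule speaks
    about.\<close>
  have "E1 a = (LBINT t:{a<..}. exp (- t) / t)"
    unfolding E1_def using AE_lborel_singleton[of a]
    by (intro set_integral_cong_set) (auto simp: set_borel_measurable_def elim!: eventually_mono)
  then show ?thesis
    by (simp add: interval_integral_to_infinity_eq)
qed

text \<open>Under the substitution \<open>t = g z\<close>, the range of \<open>z\<close> from 0 to
  infinity becomes \<open>t\<close> from \<open>a\<close> to infinity. Since
  \<open>exp (- g z)\<close> is \<open>exp (- a)\<close> times the Gaussian in \<open>z\<close>, the
  factor \<open>exp a\<close> compensates. The computation runs on Bochner integrals and returns to
  the nonnegative integral at the end.\<close>

lemma nn_integral_rayleigh_E1: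
  assumes "\<sigma> > 0" "x > 0"
  defines "a \<equiv> x\<^sup>2 / \<sigma>"
  shows "(\<integral>\<^sup>+z. ennreal (x\<^sup>2 / (x\<^sup>2 + z\<^sup>2)) \<partial>rayleigh \<sigma>) = ennreal (a * exp a * E1 a)"
proof -
  \<comment> \<open>The constant \<open>a * exp a\<close> is built in so that
    \<open>f (g z) * g' z\<close> is exactly \<open>h z\<close> for
    \<open>z \<ge> 0\<close>.\<close>
  define f where "f t = a * exp a * (exp (- t) / t)" for t
  define g where "g z = (x\<^sup>2 + z\<^sup>2) / \<sigma>" for z
  define g' where "g' z = 2 * z / \<sigma>" for z
  define h where "h z = rayleigh_density \<sigma> z * (x\<^sup>2 / (x\<^sup>2 + z\<^sup>2))" for z
  have a: "a > 0" using assms by simp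
  have xz: "x\<^sup>2 + z\<^sup>2 > 0" for z
    using assms by (intro add_pos_nonneg) auto
  have gpos: "g z > 0" for z
    using xz[of z] assms by (simp add: g_def)
  have h_nonneg: "h z \<ge> 0" for z
    using rayleigh_density_nonneg[OF assms(1), of z] xz[of z] by (simp add: h_def)
  have h_meas [measurable]: "h \<in> borel_measurable borel"
    unfolding h_def by measurable
  have fg: "f (g z) * g' z = h z" if "z \<ge> 0" for z
  proof -
    have "exp (- g z) = exp (- a) * exp (- (z\<^sup>2 / \<sigma>))"
      by (simp add: exp_add[symmetric] g_def a_def add_divide_distrib)
    then have fgz: "f (g z) = a * exp (- (z\<^sup>2 / \<sigma>)) / g z"
      by (simp add: f_def exp_minus field_simps)
    show ?thesis
      unfolding fgz using that assms(1,2) xz[of z]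
      by (simp add: h_def rayleigh_density_def g_def g'_def a_def divide_simps)
  qed
  interpret P: prob_space "rayleigh \<sigma>"
    by (rule prob_space_rayleigh) fact
  have dens_int: "integrable lborel (rayleigh_density \<sigma>)"
  proof (rule integrableI_nonneg)
    have "(\<integral>\<^sup>+z. ennreal (rayleigh_density \<sigma> z) \<partial>lborel) = emeasure (rayleigh \<sigma>) UNIV"
      by (simp add: emeasure_density)
    then show "(\<integral>\<^sup>+z. ennreal (rayleigh_density \<sigma> z) \<partial>lborel) < \<infinity>"
      using P.emeasure_space_1 by simp
  qed (use assms rayleigh_density_nonneg in auto)
  \<comment> \<open>The weight \<open>x\<^sup>2 / (x\<^sup>2 + z\<^sup>2)\<close> is at most 1, so
    \<open>h\<close> is dominated by a probability density. The substitution rule asks for this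
    integrability.\<close>
  have h_int: "integrable lborel h"
  proof (rule Bochner_Integration.integrable_bound[OF dens_int])
    have "h z \<le> rayleigh_density \<sigma> z" for z
      unfolding h_def using rayleigh_density_nonneg[OF assms(1), of z] xz[of z]
      by (intro mult_left_le) simp_all
    then show "AE z in lborel. norm (h z) \<le> norm (rayleigh_density \<sigma> z)"
      using rayleigh_density_nonneg[OF assms(1)] h_nonneg by simp
  qed simp
  have seteq: "indicator {0<..} z *\<^sub>R (f (g z) * g' z) = indicator {0<..} z *\<^sub>R h z" for z
    using fg[of z] by (auto simp: indicator_def)
  have pos0: "einterval 0 \<infinity> = {0<..}"
    by (auto simp: einterval_def)
  have glim: "filterlim g at_top at_top"
    unfolding g_def add_divide_distrib divide_inverse[of "_\<^sup>2" \<sigma>] mult.commute[of "_\<^sup>2" "inverse \<sigma>"]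
    using \<open>\<sigma> > 0\<close>
    by (intro filterlim_tendsto_add_at_top[OF tendsto_const]
        filterlim_tendsto_pos_mult_at_top[OF tendsto_const] filterlim_pow_at_top filterlim_ident) auto
  have "(LBINT t=ereal a..\<infinity>. f t) = (LBINT z=0..\<infinity>. f (g z) * g' z)"
  proof (rule interval_integral_substitution_nonneg(2))
    show "DERIV g z :> g' z" for z
      unfolding g_def g'_def using assms by (auto intro!: derivative_eq_intros)
    show "isCont f (g z)" for z
      unfolding f_def using gpos[of z] by (intro continuous_intros) auto
    show "isCont g' z" for z
      unfolding g'_def using assms by (intro continuous_intros) auto
    show "0 \<le> f (g z)" for z
      using gpos[of z] a by (simp add: f_def)
    show "0 \<le> g' z" if "0 \<le> ereal z" for z
      using that assms by (simp add: g'_def)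
    have "(g \<longlongrightarrow> g 0) (at_right 0)"
      unfolding g_def using assms by (intro tendsto_intros) auto
    then show "((ereal \<circ> g \<circ> real_of_ereal) \<longlongrightarrow> ereal a) (at_right 0)"
      by (simp add: zero_ereal_def ereal_tendsto_simps g_def a_def)
    show "((ereal \<circ> g \<circ> real_of_ereal) \<longlongrightarrow> \<infinity>) (at_left \<infinity>)"
      using glim by (simp add: ereal_tendsto_simps)
    show "set_integrable lborel (einterval 0 \<infinity>) (\<lambda>z. f (g z) * g' z)"
      unfolding pos0 set_integrable_def seteq
      by (rule integrable_mult_indicator[of _ lborel h, OF _ h_int]) simp
  qed simp
  also have "\<dots> = (LBINT z:{0<..}. h z)"
    unfolding interval_lebesgue_integral_def set_lebesgue_integral_def pos0 seteq by simp
  \<comment> \<open>\<open>h\<close> vanishes off \<open>{0<..}\<close>, so the integral extends to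
    the whole line.\<close>
  also have "\<dots> = (\<integral>z. h z \<partial>lborel)"
    unfolding set_lebesgue_integral_def using AE_lborel_singleton[of 0]
    by (intro integral_cong_AE)
       (auto simp: indicator_def h_def rayleigh_density_def elim!: eventually_mono)
  finally have int: "(\<integral>z. h z \<partial>lborel) = a * exp a * E1 a"
    by (simp only: f_def E1_eq_interval_integral interval_lebesgue_integral_mult_right)
  have "(\<integral>\<^sup>+z. ennreal (x\<^sup>2 / (x\<^sup>2 + z\<^sup>2)) \<partial>rayleigh \<sigma>) = (\<integral>\<^sup>+z. ennreal (h z) \<partial>lborel)"
    using rayleigh_density_nonneg[OF assms(1)] xz
    by (subst nn_integral_density) (auto simp: h_def simp flip: ennreal_mult' intro!: nn_integral_cong)
  also have "\<dots> = ennreal (\<integral>z. h z \<partial>lborel)"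
    using h_int h_nonneg by (intro nn_integral_eq_integral) auto
  finally show ?thesis
    using int by simp
qed

text \<open>Moving \<open>x\<close> from the domain of integration into the integrand gives a
  parameter integral of a jointly measurable function.\<close>

lemma E1_measurable [measurable]: "E1 \<in> borel_measurable borel"
proof -
  have "E1 = (\<lambda>x. \<integral>t. (if x \<le> t then exp (- t) / t else 0) \<partial>lborel)"
    unfolding E1_def set_lebesgue_integral_def
    by (intro ext Bochner_Integration.integral_cong) (auto simp: indicator_def)
  also have "\<dots> \<in> borel_measurable borel"
    by measurable
  finally show ?thesis .
qed

section \<open>Comparing two products of independent Rayleigh variables\<close>

lemma rayleigh_comparison_integral:
  assumes "\<sigma> > 0" "x > 0" "R = (<) \<or> R = (\<le>)"
  shows "(\<integral>\<^sup>+z. \<integral>\<^sup>+y. emeasure (rayleigh \<sigma>) {w. R (z * y) (x * w)} \<partial>rayleigh \<sigma> \<partial>rayleigh \<sigma>)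
    = ennreal (x\<^sup>2 / \<sigma> * exp (x\<^sup>2 / \<sigma>) * E1 (x\<^sup>2 / \<sigma>))"
proof -
  \<comment> \<open>The tail formula needs \<open>z * y \<ge> 0\<close>; this holds for almost all
    \<open>z\<close> and \<open>y\<close>.\<close>
  have "(\<integral>\<^sup>+z. \<integral>\<^sup>+y. emeasure (rayleigh \<sigma>) {w. R (z * y) (x * w)} \<partial>rayleigh \<sigma> \<partial>rayleigh \<sigma>)
    = (\<integral>\<^sup>+z. \<integral>\<^sup>+y. ennreal (exp (- ((z * y / x)\<^sup>2 / \<sigma>))) \<partial>rayleigh \<sigma> \<partial>rayleigh \<sigma>)"
    using AE_rayleigh_pos[of \<sigma>]
  proof (intro nn_integral_cong_AE, elim eventually_mono)
    fix z :: real assume z: "z > 0"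
    show "(\<integral>\<^sup>+y. emeasure (rayleigh \<sigma>) {w. R (z * y) (x * w)} \<partial>rayleigh \<sigma>)
      = (\<integral>\<^sup>+y. ennreal (exp (- ((z * y / x)\<^sup>2 / \<sigma>))) \<partial>rayleigh \<sigma>)"
      using AE_rayleigh_pos[of \<sigma>]
    proof (intro nn_integral_cong_AE, elim eventually_mono)
      fix y :: real assume "y > 0"
      then show "emeasure (rayleigh \<sigma>) {w. R (z * y) (x * w)} = ennreal (exp (- ((z * y / x)\<^sup>2 / \<sigma>)))"
        using z assms by (intro rayleigh_comparison_event) auto
    qed
  qed
  then show ?thesis
    using assms by (simp add: nn_integral_rayleigh_gaussian nn_integral_rayleigh_E1)
qed

text \<open>Independence makes the joint law a product measure, so the event is a fourfold integral
  that the previous averages evaluate from the inside out. Four abstract indices allow both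
  assignments of the roles of winner and rival. Each one contributes half of the final
  density.\<close>

lemma (in prob_space) emeasure_four_rayleigh:
  fixes Y :: "'i \<Rightarrow> 'a \<Rightarrow> real"
  assumes \<sigma>: "\<sigma> > 0" and dist: "distinct [a, b, c, d]"
    and indep: "indep_vars (\<lambda>_. borel) Y {a, b, c, d}"
    and Y: "\<And>i. i \<in> {a, b, c, d} \<Longrightarrow> distributed M lborel (Y i) (\<lambda>x. ennreal (rayleigh_density \<sigma> x))"
    and A [measurable]: "A \<in> sets borel"
    and R: "R = (<) \<or> R = (\<le>)"
  shows "emeasure M {\<omega> \<in> space M. Y a \<omega> \<in> A \<and> R (Y c \<omega> * Y d \<omega>) (Y a \<omega> * Y b \<omega>)}
    = (\<integral>\<^sup>+x. ennreal (if 0 < x then 2 * x ^ 3 / \<sigma>\<^sup>2 * E1 (x\<^sup>2 / \<sigma>) else 0) * indicator A x \<partial>lborel)"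
proof -
  let ?I = "{a, b, c, d}" and ?\<mu> = "rayleigh \<sigma>"
  \<comment> \<open>The arguments follow the order of integration: the first factor outermost, then
    the two rival factors, and the partner \<open>w\<close> innermost, where the Rayleigh tail
    applies.\<close>
  define T where "T x z y w \<longleftrightarrow> x \<in> A \<and> R (z * y) (x * w)" for x z y w
  interpret P: prob_space ?\<mu>
    by (rule prob_space_rayleigh) fact
  interpret product_sigma_finite "\<lambda>_::'i. ?\<mu>"
    by standard
  have sets_mu: "sets ?\<mu> = sets borel" by simp
  have T_meas [measurable]: "Measurable.pred N (\<lambda>p. T (f1 p) (f2 p) (f3 p) (f4 p))"
    if [measurable]: "f1 \<in> borel_measurable N" "f2 \<in> borel_measurable N"
      "f3 \<in> borel_measurable N" "f4 \<in> borel_measurable N" for N :: "'x measure" and f1 f2 f3 f4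
    using R by (elim disjE) (simp_all add: T_def)
  have Ym: "Y i \<in> borel_measurable M" if "i \<in> ?I" for i
    using distributed_measurable[OF Y[OF that]] by simp
  have Yd: "distr M borel (Y i) = ?\<mu>" if "i \<in> ?I" for i
    using distributed_distr_eq_density[OF Y[OF that]] by (metis distr_cong sets_lborel)
  \<comment> \<open>Independence in its distributional form: the joint law is the product of the
    marginals.\<close>
  have "distr M (\<Pi>\<^sub>M i\<in>?I. borel) (\<lambda>x. \<lambda>i\<in>?I. Y i x) = (\<Pi>\<^sub>M i\<in>?I. distr M borel (Y i))"
    using indep_vars_iff_distr_eq_PiM'[where I = ?I and M' = "\<lambda>_. borel" and X = Y] indep Ym by blast
  also have "\<dots> = (\<Pi>\<^sub>M i\<in>?I. ?\<mu>)"
    by (intro PiM_cong Yd) auto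
  finally have joint: "distr M (\<Pi>\<^sub>M i\<in>?I. borel) (\<lambda>x. \<lambda>i\<in>?I. Y i x) = (\<Pi>\<^sub>M i\<in>?I. ?\<mu>)" .
  have Tm: "(\<lambda>v. indicator {v. T (v a) (v c) (v d) (v b)} v :: ennreal) \<in> borel_measurable (\<Pi>\<^sub>M i\<in>?I. ?\<mu>)"
  proof -
    have [measurable]: "(\<lambda>v. v i) \<in> borel_measurable (\<Pi>\<^sub>M i\<in>?I. ?\<mu>)" if "i \<in> ?I" for i
      using measurable_component_singleton[OF that, of "\<lambda>_. ?\<mu>"] by simp
    show ?thesis
      unfolding indicator_def mem_Collect_eq by measurable
  qed
  have "emeasure M {\<omega> \<in> space M. T (Y a \<omega>) (Y c \<omega>) (Y d \<omega>) (Y b \<omega>)}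
    = (\<integral>\<^sup>+\<omega>. indicator {v. T (v a) (v c) (v d) (v b)} (\<lambda>i\<in>?I. Y i \<omega>) \<partial>M)"
  proof -
    have [measurable]: "Y a \<in> borel_measurable M" "Y b \<in> borel_measurable M"
      "Y c \<in> borel_measurable M" "Y d \<in> borel_measurable M"
      using Ym by auto
    have "{\<omega> \<in> space M. T (Y a \<omega>) (Y c \<omega>) (Y d \<omega>) (Y b \<omega>)} \<in> sets M"
      by measurable
    then have "emeasure M {\<omega> \<in> space M. T (Y a \<omega>) (Y c \<omega>) (Y d \<omega>) (Y b \<omega>)}
      = (\<integral>\<^sup>+\<omega>. indicator {\<omega> \<in> space M. T (Y a \<omega>) (Y c \<omega>) (Y d \<omega>) (Y b \<omega>)} \<omega> \<partial>M)"
      by simp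
    also have "\<dots> = (\<integral>\<^sup>+\<omega>. indicator {v. T (v a) (v c) (v d) (v b)} (\<lambda>i\<in>?I. Y i \<omega>) \<partial>M)"
      by (intro nn_integral_cong) (simp add: indicator_def)
    finally show ?thesis .
  qed
  also have "\<dots> = (\<integral>\<^sup>+v. indicator {v. T (v a) (v c) (v d) (v b)} v
      \<partial>distr M (\<Pi>\<^sub>M i\<in>?I. borel) (\<lambda>x. \<lambda>i\<in>?I. Y i x))"
    using Ym Tm by (subst nn_integral_distr)
      (auto intro!: measurable_restrict simp: measurable_cong_sets[OF sets_PiM_cong[OF refl sets_mu] refl])
  also have "\<dots> = (\<integral>\<^sup>+v. indicator {v. T (v a) (v c) (v d) (v b)} v \<partial>PiM ?I (\<lambda>_. ?\<mu>))"
    by (simp only: joint)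
  also have "\<dots> = (\<integral>\<^sup>+x. \<integral>\<^sup>+z. \<integral>\<^sup>+y. \<integral>\<^sup>+w. indicator {w. T x z y w} w \<partial>?\<mu> \<partial>?\<mu> \<partial>?\<mu> \<partial>?\<mu>)"
  proof -
    define F :: "real \<Rightarrow> real \<Rightarrow> real \<Rightarrow> real \<Rightarrow> ennreal"
      where "F x z y w = (if T x z y w then 1 else 0)" for x z y w
    have [measurable]: "(\<lambda>p. F (f1 p) (f2 p) (f3 p) (f4 p)) \<in> borel_measurable N"
      if [measurable]: "f1 \<in> borel_measurable N" "f2 \<in> borel_measurable N"
        "f3 \<in> borel_measurable N" "f4 \<in> borel_measurable N" for N :: "('i \<Rightarrow> real) measure" and f1 f2 f3 f4
      unfolding F_def by measurable
    have Fm1: "F x z y \<in> borel_measurable ?\<mu>" for x z y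
      unfolding F_def by measurable
    have comp: "(\<lambda>v. v i) \<in> borel_measurable (PiM I (\<lambda>_. ?\<mu>))" if "i \<in> I" for i :: 'i and I
      using measurable_component_singleton[OF that, of "\<lambda>_. ?\<mu>"] by simp
    \<comment> \<open>The index set is reordered to \<open>{a, c, d, b}\<close>. Splitting off one
      coordinate at a time then produces the iterated integral in the order of
      \<open>T\<close>.\<close>
    have "(\<integral>\<^sup>+v. indicator {v. T (v a) (v c) (v d) (v b)} v \<partial>PiM ?I (\<lambda>_. ?\<mu>))
      = (\<integral>\<^sup>+v. F (v a) (v c) (v d) (v b) \<partial>PiM {a, c, d, b} (\<lambda>_. ?\<mu>))"
      by (intro arg_cong2[where f = "nn_integral"] ext)
         (auto simp: F_def indicator_def insert_commute)
    also have "\<dots> = (\<integral>\<^sup>+x. \<integral>\<^sup>+v. F x (v c) (v d) (v b) \<partial>PiM {c, d, b} (\<lambda>_. ?\<mu>) \<partial>?\<mu>)"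
      using dist by (subst product_nn_integral_insert_rev) (auto intro!: comp)
    also have "\<dots> = (\<integral>\<^sup>+x. \<integral>\<^sup>+z. \<integral>\<^sup>+v. F x z (v d) (v b) \<partial>PiM {d, b} (\<lambda>_. ?\<mu>) \<partial>?\<mu> \<partial>?\<mu>)"
      using dist by (subst product_nn_integral_insert_rev) (auto intro!: comp)
    also have "\<dots> = (\<integral>\<^sup>+x. \<integral>\<^sup>+z. \<integral>\<^sup>+y. \<integral>\<^sup>+v. F x z y (v b) \<partial>PiM {b} (\<lambda>_. ?\<mu>) \<partial>?\<mu> \<partial>?\<mu> \<partial>?\<mu>)"
      using dist by (subst product_nn_integral_insert_rev) (auto intro!: comp)
    also have "\<dots> = (\<integral>\<^sup>+x. \<integral>\<^sup>+z. \<integral>\<^sup>+y. \<integral>\<^sup>+w. F x z y w \<partial>?\<mu> \<partial>?\<mu> \<partial>?\<mu> \<partial>?\<mu>)"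
      by (subst product_nn_integral_singleton[OF Fm1]) simp
    finally show ?thesis
      by (simp add: F_def indicator_def of_bool_def)
  qed
  also have "\<dots> = (\<integral>\<^sup>+x. indicator A x * (\<integral>\<^sup>+z. \<integral>\<^sup>+y. emeasure ?\<mu> {w. R (z * y) (x * w)} \<partial>?\<mu> \<partial>?\<mu>) \<partial>?\<mu>)"
  proof (intro nn_integral_cong)
    fix x :: real
    have "(\<integral>\<^sup>+w. indicator {w. R (z * y) (x * w)} w \<partial>?\<mu>) = emeasure ?\<mu> {w. R (z * y) (x * w)}" for z y
      using R by (elim disjE) simp_all
    then show "(\<integral>\<^sup>+z. \<integral>\<^sup>+y. \<integral>\<^sup>+w. indicator {w. T x z y w} w \<partial>?\<mu> \<partial>?\<mu> \<partial>?\<mu>)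
      = indicator A x * (\<integral>\<^sup>+z. \<integral>\<^sup>+y. emeasure ?\<mu> {w. R (z * y) (x * w)} \<partial>?\<mu> \<partial>?\<mu>)"
      by (cases "x \<in> A") (simp_all add: T_def)
  qed
  also have "\<dots> = (\<integral>\<^sup>+x. indicator A x * ennreal (x\<^sup>2 / \<sigma> * exp (x\<^sup>2 / \<sigma>) * E1 (x\<^sup>2 / \<sigma>)) \<partial>?\<mu>)"
    using AE_rayleigh_pos[of \<sigma>] rayleigh_comparison_integral[OF \<sigma> _ R]
    by (intro nn_integral_cong_AE) (auto elim!: eventually_mono)
  also have "\<dots> = (\<integral>\<^sup>+x. ennreal (rayleigh_density \<sigma> x) *
      (indicator A x * ennreal (x\<^sup>2 / \<sigma> * exp (x\<^sup>2 / \<sigma>) * E1 (x\<^sup>2 / \<sigma>))) \<partial>lborel)"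
    by (subst nn_integral_density) auto
  also have "\<dots> = (\<integral>\<^sup>+x. ennreal (if 0 < x then 2 * x ^ 3 / \<sigma>\<^sup>2 * E1 (x\<^sup>2 / \<sigma>) else 0) * indicator A x \<partial>lborel)"
  proof (intro nn_integral_cong)
    fix x :: real
    \<comment> \<open>The factor \<open>exp (x\<^sup>2 / \<sigma>)\<close> cancels the Gaussian of
      the density, leaving only powers of \<open>x\<close> and \<open>E1\<close>.\<close>
    have "rayleigh_density \<sigma> x * (x\<^sup>2 / \<sigma> * exp (x\<^sup>2 / \<sigma>) * E1 (x\<^sup>2 / \<sigma>))
      = (if 0 < x then 2 * x ^ 3 / \<sigma>\<^sup>2 * E1 (x\<^sup>2 / \<sigma>) else 0)"
      using \<sigma> by (auto simp: rayleigh_density_def exp_minus field_simps power2_eq_square power3_eq_cube)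
    then show "ennreal (rayleigh_density \<sigma> x) * (indicator A x * ennreal (x\<^sup>2 / \<sigma> * exp (x\<^sup>2 / \<sigma>) * E1 (x\<^sup>2 / \<sigma>)))
      = ennreal (if 0 < x then 2 * x ^ 3 / \<sigma>\<^sup>2 * E1 (x\<^sup>2 / \<sigma>) else 0) * indicator A x"
      using rayleigh_density_nonneg[OF \<sigma>, of x]
      by (cases "0 < x") (simp_all add: indicator_def rayleigh_density_def flip: ennreal_mult')
  qed
  finally show ?thesis
    by (simp add: T_def)
qed

section \<open>Density of the first factor of the larger product\<close>

theorem mainTheorem12:
  fixes M :: "'a measure" and \<sigma> :: real
    and X :: "nat \<Rightarrow> nat \<Rightarrow> 'a \<Rightarrow> real" and J :: "'a \<Rightarrow> nat"
  assumes "prob_space M"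
    and "\<sigma> > 0"
    and "prob_space.indep_vars M (\<lambda>_. borel) (\<lambda>(j, k). X j k) ({1, 2} \<times> {1, 2})"
    and "\<And>j k. j \<in> {1, 2} \<Longrightarrow> k \<in> {1, 2} \<Longrightarrow>
           distributed M lborel (X j k) (\<lambda>x. ennreal (rayleigh_density \<sigma> x))"
    and "J \<in> measurable M (count_space {1, 2})"
    and "AE \<omega> in M. is_arg_max (\<lambda>j. X j 1 \<omega> * X j 2 \<omega>) (\<lambda>j. j \<in> {1, 2}) (J \<omega>)"
  shows "distributed M lborel (\<lambda>\<omega>. X (J \<omega>) 1 \<omega>)
           (\<lambda>x. ennreal (if 0 < x then 4 * x ^ 3 / \<sigma>\<^sup>2 * E1 (x\<^sup>2 / \<sigma>) else 0))"
proof -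
  interpret prob_space M by fact
  let ?h = "\<lambda>x. ennreal (if 0 < x then 2 * x ^ 3 / \<sigma>\<^sup>2 * E1 (x\<^sup>2 / \<sigma>) else 0)"
  let ?g = "\<lambda>x. ennreal (if 0 < x then 4 * x ^ 3 / \<sigma>\<^sup>2 * E1 (x\<^sup>2 / \<sigma>) else 0)"
  let ?Z = "\<lambda>\<omega>. X (J \<omega>) 1 \<omega>"
  let ?P = "\<lambda>j \<omega>. X j 1 \<omega> * X j 2 \<omega>"
  have Xm [measurable]: "X j k \<in> borel_measurable M" if "j \<in> {1, 2}" "k \<in> {1, 2}" for j k
    using distributed_measurable[OF assms(4)[OF that]] by simp
  have [measurable]: "X 1 1 \<in> borel_measurable M" "X 1 2 \<in> borel_measurable M"
    "X 2 1 \<in> borel_measurable M" "X 2 2 \<in> borel_measurable M"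
    by (intro Xm; simp)+
  have J [measurable]: "Measurable.pred M (\<lambda>\<omega>. J \<omega> = 1)"
    using assms(5) by measurable
  have J12: "J \<omega> = 1 \<or> J \<omega> = 2" if "\<omega> \<in> space M" for \<omega>
    using measurable_space[OF assms(5) that] by auto
  \<comment> \<open>The index in \<open>X (J \<omega>) 1 \<omega>\<close> is itself random. On
    \<open>space M\<close> the variable coincides with this two-case expression, whose measurability
    is clear.\<close>
  have "(\<lambda>\<omega>. if J \<omega> = 1 then X 1 1 \<omega> else X 2 1 \<omega>) \<in> borel_measurable M"
    by measurable
  then have Zm [measurable]: "?Z \<in> borel_measurable M"
    by (rule measurable_cong[THEN iffD1, rotated]) (metis J12)
  \<comment> \<open>The value is the same for both choices of the winning index \<open>j\<close> and
    for both comparisons \<open>R\<close>.\<close>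
  have half: "emeasure M {\<omega> \<in> space M. X j 1 \<omega> \<in> A \<and> R (?P i \<omega>) (?P j \<omega>)}
      = (\<integral>\<^sup>+x. ?h x * indicator A x \<partial>lborel)"
    if "R = (<) \<or> R = (\<le>)" "A \<in> sets borel" "(j = 1 \<and> i = 2) \<or> (j = 2 \<and> i = 1)" for R A i j
  proof -
    have I: "{(j, 1), (j, 2), (i, 1), (i, 2)} = {1, 2} \<times> {1, 2::nat}"
      using that(3) by auto
    have indep: "indep_vars (\<lambda>_. borel) (\<lambda>(j, k). X j k) {(j, 1), (j, 2), (i, 1), (i, 2)}"
      unfolding I by (rule assms(3))
    have "emeasure M {\<omega> \<in> space M. (\<lambda>(j, k). X j k) (j, 1) \<omega> \<in> A \<and>
        R ((\<lambda>(j, k). X j k) (i, 1) \<omega> * (\<lambda>(j, k). X j k) (i, 2) \<omega>)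
          ((\<lambda>(j, k). X j k) (j, 1) \<omega> * (\<lambda>(j, k). X j k) (j, 2) \<omega>)}
      = (\<integral>\<^sup>+x. ?h x * indicator A x \<partial>lborel)"
      using that assms(4)
      by (intro emeasure_four_rayleigh[OF \<open>\<sigma> > 0\<close> _ indep]) auto
    then show ?thesis by simp
  qed
  have arg: "AE \<omega> in M. (J \<omega> = 1 \<and> ?P 2 \<omega> \<le> ?P 1 \<omega>) \<or> (J \<omega> = 2 \<and> ?P 1 \<omega> \<le> ?P 2 \<omega>)"
    using assms(6) by eventually_elim (auto simp: is_arg_max_def not_less)
  have gh: "?g x = 2 * ?h x" for x
  proof -
    have "(if 0 < x then 4 * x ^ 3 / \<sigma>\<^sup>2 * E1 (x\<^sup>2 / \<sigma>) else 0)
      = 2 * (if 0 < x then 2 * x ^ 3 / \<sigma>\<^sup>2 * E1 (x\<^sup>2 / \<sigma>) else 0)" by simp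
    then show ?thesis
      by (simp only: ennreal_mult' ennreal_numeral zero_le_numeral)
  qed
  have "emeasure M (?Z -` A \<inter> space M) = emeasure (density lborel ?g) A" if A [measurable]: "A \<in> sets borel" for A
  proof -
    let ?E = "\<lambda>R i j. {\<omega> \<in> space M. X j 1 \<omega> \<in> A \<and> R (?P i \<omega>) (?P j \<omega>)}"
    have AZ: "?Z -` A \<inter> space M \<in> sets M"
      using measurable_sets[OF Zm that] .
    \<comment> \<open>Since \<open>?g\<close> is twice \<open>?h\<close>, the target mass splits
      into one equal share for each value of \<open>J\<close>.\<close>
    have tot: "emeasure (density lborel ?g) A
      = (\<integral>\<^sup>+x. ?h x * indicator A x \<partial>lborel) + (\<integral>\<^sup>+x. ?h x * indicator A x \<partial>lborel)"
      by (subst emeasure_density)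
         (simp_all only: gh mult.assoc, simp_all add: mult_2 distrib_right nn_integral_add)
    have "emeasure (density lborel ?g) A = emeasure M (?E (<) 2 1) + emeasure M (?E (<) 1 2)"
      unfolding tot by (subst (1 2) half) auto
    \<comment> \<open>The two strict comparisons exclude each other, so their probabilities add
      exactly.\<close>
    also have "\<dots> = emeasure M (?E (<) 2 1 \<union> ?E (<) 1 2)"
      by (rule plus_emeasure) (measurable, auto)
    \<comment> \<open>A strict winner is almost surely the index \<open>J\<close>, so its first
      factor is \<open>?Z\<close>.\<close>
    also have "\<dots> \<le> emeasure M (?Z -` A \<inter> space M)"
      using arg by (intro emeasure_mono_AE AZ) (auto elim!: eventually_mono)
    finally have ge: "emeasure (density lborel ?g) A \<le> emeasure M (?Z -` A \<inter> space M)" .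
    \<comment> \<open>Whichever index \<open>J\<close> selects, its product almost surely wins at
      least weakly. The weak events may overlap in ties, but subadditivity suffices for an upper
      bound.\<close>
    have "emeasure M (?Z -` A \<inter> space M) \<le> emeasure M (?E (\<le>) 2 1 \<union> ?E (\<le>) 1 2)"
    proof (rule emeasure_mono_AE)
      show "AE \<omega> in M. \<omega> \<in> ?Z -` A \<inter> space M \<longrightarrow> \<omega> \<in> ?E (\<le>) 2 1 \<union> ?E (\<le>) 1 2"
        using arg by (auto elim!: eventually_mono)
    qed measurable
    also have "\<dots> \<le> emeasure M (?E (\<le>) 2 1) + emeasure M (?E (\<le>) 1 2)"
      by (rule emeasure_subadditive) measurable
    also have "\<dots> = emeasure (density lborel ?g) A"
      unfolding tot by (subst (1 2) half) auto
    finally show ?thesis using ge by (rule antisym)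
  qed
  then have "distr M lborel ?Z = density lborel ?g"
    using Zm by (intro measure_eqI) (simp_all add: emeasure_distr del: One_nat_def)
  then show ?thesis
    unfolding distributed_def using Zm by (simp del: One_nat_def)
qed

end
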